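(* Let $F$ be a field, $n\ge 1$, $m\ge 0$ an integer, and $A\in M_n(F)$. Then $A$ can be written as a product $A=HV$, where $H$ is an $n\times(n+m)$ matrix over $F$ that is almost lower triangular with $m$ extra columns and $V$ is an $(n+m)\times n$ matrix over $F$ that is almost upper triangular with $m$ extra rows, if and only if for every $k=1,\ldots,n$ $$\operatorname{rank}A[\{1,\ldots,k\}]+k+m\ \ge\ \operatorname{rank}A[\{1,\ldots,k\},\{1,\ldots,n\}]+\operatorname{rank}A[\{1,\ldots,n\},\{1,\ldots,k\}].$$
   Context: $M_n(F)$ is the set of $n\times n$ matrices over $F$. For a matrix $X$ and index sets $\alpha,\beta$, $X[\alpha,\beta]$ is the submatrix of $X$ with rows indexed by $\alpha$ and columns indexed by $\beta$, and $X[\alpha]=X[\alpha,\alpha]$. An $n\times(n+m)$ matrix $H$ is almost lower triangular with $m$ extra columns if the $n\times n$ matrix $H[\{1,\ldots,n\},\{m+1,\ldots,n+m\}]$ is lower triangular. An $(n+m)\times n$ matrix $V$ is almost upper triangular with $m$ extra rows if the $n\times n$ matrix $V[\{m+1,\ldots,n+m\},\{1,\ldots,n\}]$ is upper triangular. *)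

theory Defs
  imports "Jordan_Normal_Form.DL_Rank" "Jordan_Normal_Form.DL_Submatrix"
begin

(* Matrix indices start at 0 here, so the index set {1, ..., k} becomes {0..<k}
   and {m+1, ..., n+m} becomes {m..<n+m}. *)

(* vec_space.rank takes the length of the column vectors as an explicit parameter. *)
definition mat_rank :: "'a::field mat \<Rightarrow> nat" where
  "mat_rank A = vec_space.rank (dim_row A) A"

definition lower_triangular :: "'a::zero mat \<Rightarrow> bool" where
  "lower_triangular A \<longleftrightarrow> (\<forall>j < dim_col A. \<forall>i < j. i < dim_row A \<longrightarrow> A $$ (i, j) = 0)"

definition almost_lower_triangular :: "nat \<Rightarrow> nat \<Rightarrow> 'a::zero mat \<Rightarrow> bool" where
  "almost_lower_triangular n m H \<longleftrightarrow>
     H \<in> carrier_mat n (n + m) \<and> lower_triangular (submatrix H {0..<n} {m..<n + m})"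

definition almost_upper_triangular :: "nat \<Rightarrow> nat \<Rightarrow> 'a::zero mat \<Rightarrow> bool" where
  "almost_upper_triangular n m V \<longleftrightarrow>
     V \<in> carrier_mat (n + m) n \<and> upper_triangular (submatrix V {m..<n + m} {0..<n})"

end

theory Submission
  imports Defs "HOL-Library.Function_Algebras"
begin

text \<open>
  Let \<open>d = k + m\<close>. If \<open>A = HV\<close>, the leading \<open>k \<times> k\<close> block of \<open>A\<close> is \<open>H\<^sub>k V\<^sub>k\<close> with \<open>H\<^sub>k\<close> of width
  \<open>d\<close>, the first \<open>k\<close> rows of \<open>A\<close> factor through \<open>H\<^sub>k\<close> and its first \<open>k\<close> columns through \<open>V\<^sub>k\<close>, so
  the inequality is Sylvester's rank inequality for \<open>H\<^sub>k V\<^sub>k\<close>.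

  Conversely, rows \<open>h\<^sub>i\<close> and columns \<open>v\<^sub>i\<close> are chosen one pair at a time, keeping the rows \<open>h\<^sub>i\<close>
  subject to exactly the linear relations of the full rows of \<open>A\<close>, and likewise for columns.
  A row of \<open>A\<close> that depends on the earlier ones forces \<open>h\<^sub>k\<close>; otherwise \<open>h\<^sub>k\<close> is any solution \<open>x\<close> of
  \<open>\<langle>x, v\<^sub>j\<rangle> = a\<^sub>k\<^sub>j\<close>, made independent by the new coordinate. When both the row and the column are new, the
  corner entry can be adjusted with the new coordinates unless every solution \<open>y\<close> for the column
  already lies in the span of the \<open>v\<^sub>j\<close> and satisfies \<open>\<langle>x, y\<rangle> = a\<^sub>k\<^sub>k\<close>. In that case the kernel of \<open>H\<^sub>k\<close>
  is contained in the span of the \<open>v\<^sub>j\<close>, Sylvester's inequality is an equality, the new leading block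
  gains no rank, and the hypothesis at \<open>k + 1\<close> fails.

  Vectors of all lengths are functions on the natural numbers with bounded support, so that one
  vector space serves for all steps.
\<close>

text \<open>The simplifier uses equations of this shape extensionally, e.g. it would turn the
  vector \<open>0\<close> into \<open>\<lambda>x. 0\<close>.\<close>
declare zero_fun_apply [simp del] plus_fun_apply [simp del] times_fun_apply [simp del]
  one_fun_apply [simp del]

section \<open>Dimension of finitely spanned sets and rank-nullity\<close>

text \<open>\<open>dim\<close> is 0 on sets of infinite dimension, and the function space used below
  is infinite-dimensional, so monotonicity is stated relative to a finite spanning set
  \<open>F\<close>.\<close>

lemma (in vector_space) dim_mono_finite:
  assumes "V \<subseteq> span W" "W \<subseteq> span F" "finite F"
  shows "dim V \<le> dim W"
proof -
  obtain B where B: "B \<subseteq> W" "independent B" "W \<subseteq> span B" "card B = dim W"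
    using basis_exists by blast
  have "V \<subseteq> span B"
    using assms(1) span_minimal[OF B(3) subspace_span] by blast
  moreover have "finite B"
    using B(1,2) assms(2,3) independent_span_bound[of F B] by blast
  ultimately show ?thesis
    using dim_le_card B(4) by metis
qed

lemma (in vector_space) dim_insert_finite:
  assumes "finite S"
  shows "dim (insert x S) = (if x \<in> span S then dim S else Suc (dim S))"
proof (cases "x \<in> span S")
  case True
  then show ?thesis
    by (metis dim_span span_redundant)
next
  case False
  obtain B where B: "B \<subseteq> S" "independent B" "S \<subseteq> span B" "card B = dim S"
    using basis_exists by blast
  have fin: "finite B"
    using B(1) assms finite_subset by blast
  have span: "span B = span S"
    using B(1,3) by (meson span_minimal span_mono subset_antisym subspace_span)
  have "dim (insert x S) = card (insert x B)"
  proof (rule dim_unique[OF _ _ _ refl])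
    show "insert x B \<subseteq> insert x S"
      using B(1) by blast
    show "insert x S \<subseteq> span (insert x B)"
      using B(3) by (meson insert_subset insertI1 order_trans span_base span_mono subset_insertI)
    show "independent (insert x B)"
      using B(2) False span by (simp add: independent_insert)
  qed
  moreover have "x \<notin> B"
    using False B(1) span_base by blast
  ultimately show ?thesis
    using False B(4) fin by simp
qed

text \<open>Coefficients belong to indices, not to vectors, so a family with repeated members causes
  no trouble.\<close>

lemma (in vector_space) in_span_image_lessThan:
  fixes f :: "nat \<Rightarrow> 'b"
  shows "x \<in> span (f ` {..<k}) \<longleftrightarrow> (\<exists>t. x = (\<Sum>i<k. t i *s f i))"
proof
  show "\<exists>t. x = (\<Sum>i<k. t i *s f i)" if "x \<in> span (f ` {..<k})"
    using that
  proof (induction k arbitrary: x)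
    case (Suc k)
    then obtain c where "x - c *s f k \<in> span (f ` {..<k})"
      by (auto simp: lessThan_Suc span_breakdown_eq)
    then obtain t where t: "x - c *s f k = (\<Sum>i<k. t i *s f i)"
      using Suc.IH by blast
    have "x = (\<Sum>i<Suc k. (t(k := c)) i *s f i)"
      using t by (simp add: algebra_simps)
    then show ?case
      by blast
  qed simp
qed (auto intro!: span_sum span_scale intro: span_base)

text \<open>A basis \<open>B\<close> of the kernel extends to a basis \<open>C\<close> of
  \<open>S\<close>; \<open>f\<close> is injective on the span of \<open>C - B\<close> and maps
  \<open>C - B\<close> onto a basis of the image.\<close>

lemma (in vector_space_pair) rank_nullity:
  assumes lin: "Vector_Spaces.linear s1 s2 f" and S: "vs1.subspace S"
    and W: "S \<subseteq> vs1.span W" "finite W"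
  shows "vs1.dim S = vs2.dim (f ` S) + vs1.dim {x \<in> S. f x = 0}"
proof -
  interpret f: Vector_Spaces.linear s1 s2 f
    by (fact lin)
  let ?K = "{x \<in> S. f x = 0}"
  obtain B where B: "B \<subseteq> ?K" "vs1.independent B" "?K \<subseteq> vs1.span B" "card B = vs1.dim ?K"
    using vs1.basis_exists by blast
  obtain C where C: "B \<subseteq> C" "C \<subseteq> S" "vs1.independent C" "S \<subseteq> vs1.span C"
    using vs1.maximal_independent_subset_extend[of B S] B(1,2) by blast
  have fin: "finite C"
    using C(2,3) W vs1.independent_span_bound[of W C] by blast
  have dimS: "vs1.dim S = card C"
    using vs1.basis_card_eq_dim[OF C(2,4,3)] by simp
  have subS: "vs1.span (C - B) \<subseteq> S"
    using C(2) S by (meson Diff_subset order_trans vs1.span_minimal)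
  have inj: "inj_on f (vs1.span (C - B))"
    unfolding f.inj_on_iff_eq_0[OF vs1.subspace_span]
  proof safe
    fix x
    assume x: "x \<in> vs1.span (C - B)" and "f x = 0"
    then have "x \<in> vs1.span B"
      using B(3) subS by blast
    \<comment> \<open>Both expansions agree with the one over \<open>C\<close>, yet they are
      supported on the disjoint sets \<open>B\<close> and \<open>C - B\<close>, so every coefficient
      vanishes.\<close>
    then have "vs1.representation B x = vs1.representation (C - B) x"
      using x C(1,3) by (metis Diff_subset vs1.representation_extend)
    then have "vs1.representation (C - B) x b = 0" for b
      using vs1.representation_ne_zero[of B x b] vs1.representation_ne_zero[of "C - B" x b] by auto
    moreover have "vs1.independent (C - B)"
      using C(3) vs1.independent_mono by blast
    ultimately show "x = 0"
      using vs1.sum_nonzero_representation_eq[OF _ x] by simp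
  qed
  have "vs2.dim (f ` S) = card (f ` (C - B))"
  proof (rule vs2.dim_unique[OF _ _ _ refl])
    show "f ` (C - B) \<subseteq> f ` S"
      using C(2) by blast
    have "f ` C \<subseteq> vs2.span (f ` (C - B))"
    proof safe
      fix c
      assume "c \<in> C"
      then show "f c \<in> vs2.span (f ` (C - B))"
        using B(1) f.zero vs2.span_zero[of "f ` (C - B)"]
        by (cases "c \<in> B") (auto intro: vs2.span_base)
    qed
    then show "f ` S \<subseteq> vs2.span (f ` (C - B))"
      using f.spans_image[OF C(4)] vs2.span_minimal[OF _ vs2.subspace_span] by blast
    show "vs2.independent (f ` (C - B))"
      using C(3) inj f.independent_injective_image vs1.independent_mono by blast
  qed
  also have "\<dots> = card (C - B)"
    using inj by (intro card_image) (meson inj_on_subset vs1.span_superset)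
  finally show ?thesis
    using dimS B(4) C(1) fin card_mono[OF fin C(1)] by (simp add: card_Diff_subset finite_subset)
qed

lemma (in vector_space_pair) dim_image_le_finite:
  assumes "Vector_Spaces.linear s1 s2 f" "finite S"
  shows "vs2.dim (f ` S) \<le> vs1.dim S"
proof -
  have "vs1.dim (vs1.span S) = vs2.dim (f ` vs1.span S)
      + vs1.dim {x \<in> vs1.span S. f x = 0}"
    using assms by (intro rank_nullity) auto
  moreover have "vs2.dim (f ` S) = vs2.dim (f ` vs1.span S)"
    using linear_span_image[OF assms(1)] by (metis vs2.dim_span)
  ultimately show ?thesis
    by simp
qed

section \<open>Vectors as functions of bounded support\<close>

definition fscale :: "'a::field \<Rightarrow> (nat \<Rightarrow> 'a) \<Rightarrow> nat \<Rightarrow> 'a" where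
  "fscale c x = (\<lambda>i. c * x i)"

lemma fscale_apply: "fscale c x i = c * x i"
  by (simp add: fscale_def)

interpretation fs: vector_space fscale
  by unfold_locales (simp_all add: fscale_apply plus_fun_apply fun_eq_iff algebra_simps)

interpretation fsp: vector_space_pair fscale fscale
  by unfold_locales

lemma sum_fun_apply: "(\<Sum>i\<in>I. f i) x = (\<Sum>i\<in>I. f i x)"
  by (induction I rule: infinite_finite_induct) (auto simp: zero_fun_apply plus_fun_apply)

lemmas pointwise = fscale_apply zero_fun_apply plus_fun_apply sum_fun_apply

definition unitf :: "nat \<Rightarrow> nat \<Rightarrow> 'a::field" where
  "unitf l = (\<lambda>i. if i = l then 1 else 0)"

definition supp :: "nat \<Rightarrow> (nat \<Rightarrow> 'a::field) set" where
  "supp d = {x. \<forall>l\<ge>d. x l = 0}"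

lemma suppD: "x \<in> supp d \<Longrightarrow> d \<le> l \<Longrightarrow> x l = 0"
  by (simp add: supp_def)

lemma supp_mono: "d \<le> e \<Longrightarrow> supp d \<subseteq> supp e"
  by (auto simp: supp_def)

lemma subspace_supp: "fs.subspace (supp d)"
  by (auto simp: fs.subspace_def supp_def pointwise)

lemma supp_expand:
  assumes "x \<in> supp d"
  shows "x = (\<Sum>l<d. fscale (x l) (unitf l))"
proof
  show "x i = (\<Sum>l<d. fscale (x l) (unitf l)) i" for i
    using assms
    by (simp add: pointwise unitf_def suppD if_distrib[of "(*) _"] cong: if_cong)
qed

lemma span_unitf: "fs.span (unitf ` {..<d}) = supp d"
proof
  show "fs.span (unitf ` {..<d}) \<subseteq> supp d"
    by (intro fs.span_minimal subspace_supp) (auto simp: supp_def unitf_def)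
  show "supp d \<subseteq> fs.span (unitf ` {..<d})"
    using fs.in_span_image_lessThan supp_expand by blast
qed

lemma dim_supp: "fs.dim (supp d :: (nat \<Rightarrow> 'a::field) set) = d"
proof -
  have "fs.dim (unitf ` {..<d} :: (nat \<Rightarrow> 'a) set) = d"
  proof (induction d)
    case (Suc d)
    have "(unitf d :: nat \<Rightarrow> 'a) \<notin> supp d"
      by (auto simp: supp_def unitf_def)
    then show ?case
      using Suc by (simp add: lessThan_Suc fs.dim_insert_finite span_unitf)
  qed (simp add: fs.dim_eq_card_independent[OF fs.independent_empty])
  then show ?thesis
    by (metis fs.dim_span span_unitf)
qed

section \<open>Dot products and solvability of linear systems\<close>

text \<open>The explicit cutoff makes the form bilinear on all functions; by \<open>dot_cut\<close>
  its value is stable once \<open>d\<close> bounds the support of one argument.\<close>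

definition dot :: "nat \<Rightarrow> (nat \<Rightarrow> 'a::field) \<Rightarrow> (nat \<Rightarrow> 'a) \<Rightarrow> 'a" where
  "dot d x y = (\<Sum>l<d. x l * y l)"

lemma dot_commute: "dot d x y = dot d y x"
  by (simp add: dot_def mult.commute)

lemma dot_add: "dot d x (y + z) = dot d x y + dot d x z"
  by (simp add: dot_def pointwise sum.distrib algebra_simps)

lemma dot_scale: "dot d x (fscale c y) = c * dot d x y"
  by (simp add: dot_def pointwise sum_distrib_left algebra_simps)

lemma dot_sum: "dot d x (\<Sum>i\<in>I. f i) = (\<Sum>i\<in>I. dot d x (f i))"
  by (simp add: dot_def pointwise sum_distrib_left sum.swap[of _ I])

lemma dot_sum_left: "dot d (\<Sum>i\<in>I. f i) y = (\<Sum>i\<in>I. dot d (f i) y)"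
  by (simp add: dot_commute[of _ _ y] dot_sum)

lemma dot_scale_left: "dot d (fscale c x) y = c * dot d x y"
  by (simp add: dot_commute[of _ _ y] dot_scale)

lemma dot_cut:
  assumes "x \<in> supp d \<or> y \<in> supp d" "d \<le> e"
  shows "dot e x y = dot d x y"
  unfolding dot_def using assms by (intro sum.mono_neutral_right) (auto simp: suppD)

text \<open>A coordinate of a linear map is a functional, represented on \<open>supp d\<close> by
  its values on the unit vectors. The default 0 from \<open>d\<close> on keeps the representing
  vector in \<open>supp d\<close>.\<close>

lemma linear_eq_dot:
  assumes "Vector_Spaces.linear fscale fscale g" "x \<in> supp d"
  shows "g x i = dot d (\<lambda>l. if l < d then g (unitf l) i else 0) x"
proof -
  have "g x = (\<Sum>l<d. fscale (x l) (g (unitf l)))"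
    using arg_cong[OF supp_expand[OF assms(2)], of g]
    by (simp add: fsp.linear_sum[OF assms(1)] fsp.linear_scale[OF assms(1)])
  then show ?thesis
    by (simp add: dot_def pointwise mult.commute)
qed

text \<open>\<open>v\<close> is added to a basis \<open>B\<close> of the span of \<open>U\<close>; a
  linear map sending \<open>B\<close> to 0 and \<open>v\<close> to \<open>unitf 0\<close> is read
  off at coordinate 0, and \<open>linear_eq_dot\<close> turns that functional into a vector.\<close>

lemma separating_functional:
  assumes "U \<subseteq> supp d" "v \<in> supp d" "v \<notin> fs.span U"
  obtains u where "u \<in> supp d" "\<And>w. w \<in> U \<Longrightarrow> dot d u w = 0" "dot d u v = 1"
proof -
  obtain B where B: "B \<subseteq> U" "fs.independent B" "U \<subseteq> fs.span B"
    using fs.basis_exists[of U] by metis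
  have "v \<notin> fs.span B"
    using assms(3) B(1) fs.span_mono by blast
  then have ind: "fs.independent (insert v B)" and vB: "v \<notin> B"
    using B(2) by (auto simp: fs.independent_insert fs.span_base)
  obtain g where g: "Vector_Spaces.linear fscale fscale g"
      "\<And>x. x \<in> insert v B \<Longrightarrow> g x = (if x = v then unitf 0 else 0)"
    using fsp.linear_independent_extend[OF ind, of "\<lambda>x. if x = v then unitf 0 else 0"] by blast
  let ?u = "\<lambda>l. if l < d then g (unitf l) 0 else 0"
  have "?u \<in> supp d"
    by (simp add: supp_def)
  moreover have "dot d ?u w = 0" if "w \<in> U" for w
  proof -
    have "g w = 0"
      using fsp.linear_eq_0_on_span[OF g(1), of B w] g(2) vB B(3) that by fastforce
    then show ?thesis
      using linear_eq_dot[OF g(1), of w d 0] that assms(1)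
      by (auto simp: zero_fun_apply)
  qed
  moreover have "dot d ?u v = 1"
    using linear_eq_dot[OF g(1) assms(2), of 0] g(2)[of v] by (simp add: unitf_def)
  ultimately show ?thesis
    using that by blast
qed

text \<open>The Fredholm alternative: consistency with all relations among the \<open>v j\<close>
  suffices. If \<open>v k\<close> depends on the earlier vectors, its equation holds automatically;
  otherwise a functional vanishing on them adjusts its value.\<close>

lemma dot_system_solvable:
  fixes k :: nat
  assumes "\<And>j. j < k \<Longrightarrow> v j \<in> supp d"
    and "\<And>z. (\<Sum>j<k. fscale (z j) (v j)) = 0 \<Longrightarrow> (\<Sum>j<k. z j * b j) = 0"
  shows "\<exists>x \<in> supp d. \<forall>j<k. dot d x (v j) = b j"
  using assms
proof (induction k)
  case 0
  have "0 \<in> supp d"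
    by (rule fs.subspace_0[OF subspace_supp])
  then show ?case
    by blast
next
  case (Suc k)
  have "(\<Sum>j<k. z j * b j) = 0" if "(\<Sum>j<k. fscale (z j) (v j)) = 0" for z
  proof -
    have "(\<Sum>j<k. fscale ((z(k := 0)) j) (v j)) = (\<Sum>j<k. fscale (z j) (v j))"
      by (intro sum.cong) auto
    then have "(\<Sum>j<k. (z(k := 0)) j * b j) = 0"
      using Suc.prems(2)[of "z(k := 0)"] that by simp
    then show ?thesis
      by simp
  qed
  then obtain x where x: "x \<in> supp d" "\<And>j. j < k \<Longrightarrow> dot d x (v j) = b j"
    using Suc.IH Suc.prems(1) less_SucI by metis
  show ?case
  proof (cases "v k \<in> fs.span (v ` {..<k})")
    case True
    then obtain t where t: "v k = (\<Sum>j<k. fscale (t j) (v j))"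
      using fs.in_span_image_lessThan by blast
    \<comment> \<open>The coefficient -1 at \<open>k\<close> turns the expansion of
      \<open>v k\<close> into a relation, whose consistency condition determines
      \<open>b k\<close>.\<close>
    have "(\<Sum>j<k. fscale ((t(k := -1)) j) (v j)) = (\<Sum>j<k. fscale (t j) (v j))"
      by (intro sum.cong) auto
    then have "(\<Sum>j<k. (t(k := -1)) j * b j) = b k"
      using Suc.prems(2)[of "t(k := -1)"] t by simp
    then have "b k = (\<Sum>j<k. t j * b j)"
      by simp
    then have "dot d x (v k) = b k"
      by (simp add: t dot_sum dot_scale x(2))
    then show ?thesis
      using x by (auto simp: less_Suc_eq)
  next
    case False
    have "v ` {..<k} \<subseteq> supp d"
      using Suc.prems(1) by auto
    with separating_functional[OF this Suc.prems(1) False]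
    obtain u where u: "u \<in> supp d" "\<And>w. w \<in> v ` {..<k} \<Longrightarrow> dot d u w = 0" "dot d u (v k) = 1"
      by (metis lessI)
    \<comment> \<open>\<open>u\<close> is orthogonal to the earlier vectors and pairs to 1 with
      \<open>v k\<close>, so this correction affects equation \<open>k\<close> alone.\<close>
    let ?x = "x + fscale (b k - dot d x (v k)) u"
    have eq: "dot d ?x (v j) = dot d x (v j) + (b k - dot d x (v k)) * dot d u (v j)" for j
      using dot_add dot_scale dot_commute by metis
    have "?x \<in> supp d"
      using x(1) u(1) by (simp add: supp_def pointwise)
    moreover have "dot d ?x (v j) = b j" if "j < Suc k" for j
      using that u(2,3) x(2) by (auto simp: eq less_Suc_eq)
    ultimately show ?thesis
      by blast
  qed
qed

section \<open>Row rank, column rank and Sylvester's inequality\<close>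

text \<open>Expanding each column in a basis \<open>B\<close> of the columns exhibits every row as a
  combination of the coefficient rows \<open>g b\<close>, one for each member of
  \<open>B\<close>.\<close>

lemma row_rank_le_col_rank:
  "fs.dim ((\<lambda>i j. if j < q then f i j else 0) ` {..<p})
    \<le> fs.dim ((\<lambda>j i. if i < p then f i j else 0) ` {..<q})"
proof -
  define C where "C = (\<lambda>j i. if i < p then f i j else 0)"
  obtain B where B: "B \<subseteq> C ` {..<q}" "C ` {..<q} \<subseteq> fs.span B" "card B = fs.dim (C ` {..<q})"
    using fs.basis_exists by metis
  have fin: "finite B"
    using B(1) finite_surj by blast
  have "\<exists>c. C j = (\<Sum>b\<in>B. fscale (c b) b)" if "j < q" for j
    using B(2) that fs.span_finite[OF fin] by force
  then obtain c where c: "\<And>j. j < q \<Longrightarrow> C j = (\<Sum>b\<in>B. fscale (c j b) b)"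
    by metis
  define g where "g b = (\<lambda>j. if j < q then c j b else 0)" for b
  have "(\<lambda>j. if j < q then f i j else 0) = (\<Sum>b\<in>B. fscale (b i) (g b))" if "i < p" for i
  proof
    fix j
    have "f i j = (\<Sum>b\<in>B. c j b * b i)" if "j < q"
      using fun_cong[OF c[OF that], of i] \<open>i < p\<close> by (simp add: C_def pointwise)
    then show "(if j < q then f i j else 0) = (\<Sum>b\<in>B. fscale (b i) (g b)) j"
      by (simp add: pointwise g_def mult.commute)
  qed
  then have "(\<lambda>i j. if j < q then f i j else 0) ` {..<p} \<subseteq> fs.span (g ` B)"
    by (auto intro!: fs.span_sum fs.span_scale intro: fs.span_base)
  then have "fs.dim ((\<lambda>i j. if j < q then f i j else 0) ` {..<p}) \<le> card (g ` B)"
    using fs.dim_le_card fin by blast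
  also have "\<dots> \<le> fs.dim (C ` {..<q})"
    using B(3) card_image_le[OF fin] by metis
  finally show ?thesis
    unfolding C_def .
qed

lemma row_rank_eq_col_rank:
  "fs.dim ((\<lambda>i j. if j < q then f i j else 0) ` {..<p})
    = fs.dim ((\<lambda>j i. if i < p then f i j else 0) ` {..<q})"
  using row_rank_le_col_rank[of q f p] row_rank_le_col_rank[of p "\<lambda>j i. f i j" q] by simp

text \<open>The matrix with rows \<open>h i\<close>, cut to width \<open>d\<close>, times the column
  \<open>y\<close>. Padding with 0 from \<open>p\<close> on keeps all values in the one function
  space.\<close>

definition dots :: "nat \<Rightarrow> nat \<Rightarrow> (nat \<Rightarrow> nat \<Rightarrow> 'a::field) \<Rightarrow> (nat \<Rightarrow> 'a) \<Rightarrow> nat \<Rightarrow> 'a" where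
  "dots d p h y = (\<lambda>i. if i < p then dot d (h i) y else 0)"

lemma linear_dots: "Vector_Spaces.linear fscale fscale (dots d p h)"
  unfolding Vector_Spaces.linear_iff
  by (auto simp: dots_def fun_eq_iff pointwise dot_add dot_scale fs.vector_space_axioms)

lemma dots_eq_0_iff: "dots d p h y = 0 \<longleftrightarrow> (\<forall>i<p. dot d (h i) y = 0)"
  by (auto simp: dots_def fun_eq_iff zero_fun_apply)

text \<open>Rank-nullity on \<open>supp d\<close>: the image is the column space of the matrix with
  rows \<open>h i\<close>, and its dimension equals the row rank.\<close>

lemma dim_kernel_dots:
  assumes "\<And>i. i < p \<Longrightarrow> h i \<in> supp d"
  shows "fs.dim {y \<in> supp d. dots d p h y = 0} + fs.dim (h ` {..<p}) = d"
proof -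
  have "dots d p h (unitf l) = (\<lambda>i. if i < p then h i l else 0)" if "l < d" for l
    using that by (auto simp: dots_def dot_def unitf_def fun_eq_iff if_distrib[of "(*) _"] cong: if_cong)
  then have img: "dots d p h ` unitf ` {..<d} = (\<lambda>l i. if i < p then h i l else 0) ` {..<d}"
    by (auto simp: image_image)
  have "dots d p h ` supp d = fs.span (dots d p h ` unitf ` {..<d})"
    using fsp.linear_span_image[OF linear_dots] span_unitf by metis
  then have "fs.dim (dots d p h ` supp d) = fs.dim ((\<lambda>l i. if i < p then h i l else 0) ` {..<d})"
    by (simp add: img)
  also have "\<dots> = fs.dim ((\<lambda>i l. if l < d then h i l else 0) ` {..<p})"
    by (rule row_rank_eq_col_rank[symmetric])
  also have "(\<lambda>i l. if l < d then h i l else 0) ` {..<p} = h ` {..<p}"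
    using suppD[OF assms] by (intro image_cong refl) (auto simp: fun_eq_iff not_less)
  finally show ?thesis
    using fsp.rank_nullity[OF linear_dots subspace_supp, of d "unitf ` {..<d}" d p h]
    by (simp add: span_unitf dim_supp)
qed

text \<open>Rank-nullity for that matrix restricted to the span of the \<open>v j\<close>, whose
  images are the columns of the product.\<close>

lemma dim_image_dots:
  fixes v :: "nat \<Rightarrow> nat \<Rightarrow> 'a::field"
  shows
  "fs.dim (v ` {..<q}) = fs.dim ((\<lambda>j i. if i < p then dot d (h i) (v j) else 0) ` {..<q})
    + fs.dim {y \<in> fs.span (v ` {..<q}). dots d p h y = 0}"
proof -
  have "fs.dim (dots d p h ` fs.span (v ` {..<q})) = fs.dim (dots d p h ` v ` {..<q})"
    using fsp.linear_span_image[OF linear_dots] fs.dim_span by metis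
  also have "dots d p h ` v ` {..<q} = (\<lambda>j i. if i < p then dot d (h i) (v j) else 0) ` {..<q}"
    by (auto simp: image_image dots_def)
  finally show ?thesis
    using fsp.rank_nullity[OF linear_dots fs.subspace_span, of "v ` {..<q}" "v ` {..<q}" d p h]
    by simp
qed

text \<open>The kernel inside the span of the \<open>v j\<close> is no larger than the kernel in
  \<open>supp d\<close>, which has dimension \<open>d\<close> minus the rank of
  \<open>h\<close>.\<close>

lemma sylvester_rank:
  fixes v :: "nat \<Rightarrow> nat \<Rightarrow> 'a::field"
  assumes "\<And>i. i < p \<Longrightarrow> h i \<in> supp d" and "\<And>j. j < q \<Longrightarrow> v j \<in> supp d"
  shows "fs.dim (h ` {..<p}) + fs.dim (v ` {..<q})
    \<le> fs.dim ((\<lambda>j i. if i < p then dot d (h i) (v j) else 0) ` {..<q}) + d"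
proof -
  have "fs.span (v ` {..<q}) \<subseteq> supp d"
    using assms(2) by (intro fs.span_minimal subspace_supp) auto
  then have "fs.dim {y \<in> fs.span (v ` {..<q}). dots d p h y = 0}
      \<le> fs.dim {y \<in> supp d. dots d p h y = 0}"
    by (intro fs.dim_mono_finite[of _ _ "unitf ` {..<d}"])
      (auto simp: span_unitf intro: fs.span_base)
  then show ?thesis
    using dim_kernel_dots[of p h d, OF assms(1)] dim_image_dots[of v q p d h] by simp
qed

section \<open>Families with the same linear relations\<close>

text \<open>Equivalently, \<open>f i\<close> maps to \<open>g i\<close> under a well-defined linear
  isomorphism between the spans.\<close>

definition same_rel :: "nat \<Rightarrow> (nat \<Rightarrow> nat \<Rightarrow> 'a::field) \<Rightarrow> (nat \<Rightarrow> nat \<Rightarrow> 'a) \<Rightarrow> bool" where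
  "same_rel k f g \<longleftrightarrow>
    (\<forall>z. (\<Sum>i<k. fscale (z i) (f i)) = 0 \<longleftrightarrow> (\<Sum>i<k. fscale (z i) (g i)) = 0)"

lemma same_rel_sym: "same_rel k f g \<Longrightarrow> same_rel k g f"
  by (simp add: same_rel_def)

text \<open>Dependence of the last member is itself a relation, with coefficient -1 at
  \<open>k\<close>, so it carries over.\<close>

lemma same_rel_span:
  fixes f g :: "nat \<Rightarrow> nat \<Rightarrow> 'a::field"
  assumes "same_rel (Suc k) f g" "f k \<in> fs.span (f ` {..<k})"
  shows "g k \<in> fs.span (g ` {..<k})"
proof -
  obtain t where t: "f k = (\<Sum>i<k. fscale (t i) (f i))"
    using assms(2) fs.in_span_image_lessThan by blast
  let ?t = "t(k := -1)"
  have upd: "(\<Sum>i<Suc k. fscale (?t i) (f' i)) = (\<Sum>i<k. fscale (t i) (f' i)) - f' k"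
    for f' :: "nat \<Rightarrow> nat \<Rightarrow> 'a"
    by (simp add: fs.scale_minus_left)
  have "(\<Sum>i<Suc k. fscale (?t i) (f i)) = 0"
    unfolding upd using t by simp
  then have "(\<Sum>i<Suc k. fscale (?t i) (g i)) = 0"
    using assms(1) by (simp only: same_rel_def)
  then have "g k = (\<Sum>i<k. fscale (t i) (g i))"
    unfolding upd by simp
  then show ?thesis
    using fs.in_span_image_lessThan by blast
qed

lemma same_rel_Suc_imp:
  fixes f g :: "nat \<Rightarrow> nat \<Rightarrow> 'a::field"
  assumes "same_rel (Suc k) f g"
  shows "same_rel k f g"
  unfolding same_rel_def
proof
  fix z
  have "(\<Sum>i<Suc k. fscale ((z(k := 0)) i) (f' i)) = (\<Sum>i<k. fscale (z i) (f' i))"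
    for f' :: "nat \<Rightarrow> nat \<Rightarrow> 'a"
    by simp
  then show "(\<Sum>i<k. fscale (z i) (f i)) = 0 \<longleftrightarrow> (\<Sum>i<k. fscale (z i) (g i)) = 0"
    using assms unfolding same_rel_def by metis
qed

text \<open>By \<open>same_rel_span\<close>, both dimensions grow at the same indices.\<close>

lemma same_rel_dim: "same_rel k f g \<Longrightarrow> fs.dim (f ` {..<k}) = fs.dim (g ` {..<k})"
proof (induction k)
  case (Suc k)
  have "f k \<in> fs.span (f ` {..<k}) \<longleftrightarrow> g k \<in> fs.span (g ` {..<k})"
    using same_rel_span same_rel_sym Suc.prems by blast
  then show ?case
    using Suc.IH[OF same_rel_Suc_imp[OF Suc.prems]]
    by (simp add: lessThan_Suc fs.dim_insert_finite)
qed simp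

lemma not_in_span_relation:
  fixes k :: nat
  assumes "x \<notin> fs.span (f ` {..<k})" "(\<Sum>i<k. fscale (z i) (f i)) + fscale c x = 0"
  shows "c = 0"
proof (rule ccontr)
  assume "c \<noteq> 0"
  have "(\<Sum>i<k. fscale (z i) (f i)) \<in> fs.span (f ` {..<k})"
    unfolding fs.in_span_image_lessThan by blast
  moreover have "fscale c x = - (\<Sum>i<k. fscale (z i) (f i))"
    using assms(2) by (simp add: add_eq_0_iff)
  ultimately have "fscale c x \<in> fs.span (f ` {..<k})"
    using fs.span_neg by simp
  then have "fscale (1 / c) (fscale c x) \<in> fs.span (f ` {..<k})"
    by (rule fs.span_scale)
  then show False
    using assms(1) \<open>c \<noteq> 0\<close> by simp
qed

text \<open>On either side a relation must have coefficient 0 at \<open>k\<close>, which leaves a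
  relation among the old members.\<close>

lemma same_rel_Suc_notin:
  assumes "same_rel k f g" "x \<notin> fs.span (f ` {..<k})" "g k \<notin> fs.span (g ` {..<k})"
  shows "same_rel (Suc k) (f(k := x)) g"
  unfolding same_rel_def
proof
  fix z
  show "(\<Sum>i<Suc k. fscale (z i) ((f(k := x)) i)) = 0 \<longleftrightarrow> (\<Sum>i<Suc k. fscale (z i) (g i)) = 0"
  proof (cases "z k = 0")
    case True
    then show ?thesis
      using assms(1) by (simp add: same_rel_def)
  next
    case False
    then show ?thesis
      using not_in_span_relation[OF assms(2), of z "z k"]
        not_in_span_relation[OF assms(3), of z "z k"] by auto
  qed
qed

text \<open>Eliminating the last member with the same \<open>t\<close> on both sides turns a
  relation \<open>z\<close> into the coefficients \<open>z i + z k * t i\<close> on the old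
  members.\<close>

lemma same_rel_Suc_in:
  fixes f g :: "nat \<Rightarrow> nat \<Rightarrow> 'a::field"
  assumes "same_rel k f g" "x = (\<Sum>i<k. fscale (t i) (f i))" "g k = (\<Sum>i<k. fscale (t i) (g i))"
  shows "same_rel (Suc k) (f(k := x)) g"
  unfolding same_rel_def
proof
  fix z
  have "(\<Sum>i<k. fscale (z i) (f' i)) + fscale (z k) (\<Sum>i<k. fscale (t i) (f' i))
      = (\<Sum>i<k. fscale (z i + z k * t i) (f' i))" for f' :: "nat \<Rightarrow> nat \<Rightarrow> 'a"
    by (simp add: fs.scale_sum_right sum.distrib fs.scale_left_distrib)
  then show "(\<Sum>i<Suc k. fscale (z i) ((f(k := x)) i)) = 0 \<longleftrightarrow> (\<Sum>i<Suc k. fscale (z i) (g i)) = 0"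
    using assms(1) by (simp add: same_rel_def assms(2,3))
qed

section \<open>Adding one row and one column to the factorization\<close>

lemma dot_Suc_extend:
  assumes "x \<in> supp d"
  shows "dot (Suc d) (x + fscale c (unitf d)) y = dot d x y + c * y d"
    and "dot (Suc d) y (x + fscale c (unitf d)) = dot d y x + y d * c"
proof -
  show *: "dot (Suc d) (x + fscale c (unitf d)) y = dot d x y + c * y d" for y
    using assms by (simp add: dot_def pointwise unitf_def suppD)
  show "dot (Suc d) y (x + fscale c (unitf d)) = dot d y x + y d * c"
    by (simp add: dot_commute[of _ y] * mult.commute)
qed

lemma extend_in_supp: "x \<in> supp d \<Longrightarrow> x + fscale c (unitf d) \<in> supp (Suc d)"
  by (simp add: supp_def pointwise unitf_def)

text \<open>Every vector in the span of \<open>U\<close> vanishes at coordinate \<open>d\<close>,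
  where the extended vector has the value \<open>c\<close>.\<close>

lemma extend_notin_span:
  assumes "x \<in> supp d" "c \<noteq> 0" "U \<subseteq> supp d"
  shows "x + fscale c (unitf d) \<notin> fs.span U"
proof
  assume "x + fscale c (unitf d) \<in> fs.span U"
  then have "x + fscale c (unitf d) \<in> supp d"
    using fs.span_minimal[OF assms(3) subspace_supp] by blast
  then have "(x + fscale c (unitf d)) d = 0"
    by (rule suppD) simp
  then show False
    using assms(2) suppD[OF assms(1) order_refl] by (simp add: pointwise unitf_def)
qed

text \<open>A relation among the \<open>v j\<close> holds among the columns of \<open>a\<close>;
  read in row \<open>l\<close>, it is the consistency condition for the right-hand sides
  \<open>a l j\<close>.\<close>

lemma relation_transfer_solvable:
  fixes v a :: "nat \<Rightarrow> nat \<Rightarrow> 'a::field"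
  assumes "\<And>j. j < k \<Longrightarrow> v j \<in> supp d" "same_rel k v (\<lambda>j i. a i j)"
  obtains x where "x \<in> supp d" "\<And>j. j < k \<Longrightarrow> dot d x (v j) = a l j"
proof -
  have "(\<Sum>j<k. z j * a l j) = 0" if "(\<Sum>j<k. fscale (z j) (v j)) = 0" for z
  proof -
    have "(\<Sum>j<k. fscale (z j) (\<lambda>i. a i j)) = 0"
      using assms(2) that by (simp add: same_rel_def)
    from fun_cong[OF this, of l] show ?thesis
      by (simp add: pointwise)
  qed
  then show ?thesis
    using dot_system_solvable[of k v d "a l"] assms(1) that by blast
qed

text \<open>The obstructed case: no choice of the new column leaves the span of \<open>v\<close> or changes the
  corner entry.\<close>
lemma dependent_corner_rank:
  fixes h v a :: "nat \<Rightarrow> nat \<Rightarrow> 'a::field"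
  assumes h: "\<And>i. i < k \<Longrightarrow> h i \<in> supp d" and v: "\<And>j. j < k \<Longrightarrow> v j \<in> supp d"
    and prod: "\<And>i j. i < k \<Longrightarrow> j < k \<Longrightarrow> dot d (h i) (v j) = a i j"
    and x: "\<And>j. j < k \<Longrightarrow> dot d x (v j) = a k j"
    and y: "y \<in> supp d" "\<And>i. i < k \<Longrightarrow> dot d (h i) y = a i k"
    and corner: "\<And>y'. y' \<in> supp d \<Longrightarrow> \<forall>i<k. dot d (h i) y' = a i k \<Longrightarrow>
        y' \<in> fs.span (v ` {..<k}) \<and> dot d x y' = a k k"
  shows "fs.dim (h ` {..<k}) + fs.dim (v ` {..<k})
    = fs.dim ((\<lambda>j i. if i < Suc k then a i j else 0) ` {..<Suc k}) + d"
proof -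
  let ?h = "h(k := x)"
  let ?M = "\<lambda>j i. if i < Suc k then a i j else 0"
  have ker: "{w \<in> fs.span (v ` {..<k}). dots d (Suc k) ?h w = 0} = {w \<in> supp d. dots d k h w = 0}"
  proof (rule Set.set_eqI, rule iffI)
    fix w
    assume "w \<in> {w \<in> fs.span (v ` {..<k}). dots d (Suc k) ?h w = 0}"
    then have w: "w \<in> fs.span (v ` {..<k})" "\<forall>i<Suc k. dot d (?h i) w = 0"
      by (auto simp: dots_eq_0_iff)
    have "fs.span (v ` {..<k}) \<subseteq> supp d"
      using v by (intro fs.span_minimal subspace_supp) auto
    moreover have "dot d (h i) w = 0" if "i < k" for i
      using w(2)[rule_format, of i] that by simp
    ultimately show "w \<in> {w \<in> supp d. dots d k h w = 0}"
      using w(1) by (auto simp: dots_eq_0_iff)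
  next
    fix w
    assume "w \<in> {w \<in> supp d. dots d k h w = 0}"
    then have w: "w \<in> supp d" "\<And>i. i < k \<Longrightarrow> dot d (h i) w = 0"
      by (auto simp: dots_eq_0_iff)
    have y': "y \<in> fs.span (v ` {..<k})" "dot d x y = a k k"
      using corner y by auto
    \<comment> \<open>Both \<open>y\<close> and \<open>y + w\<close> solve the column equations, so
      \<open>corner\<close> puts both in the span and gives both the same product with
      \<open>x\<close>; their difference \<open>w\<close> is thus in the span and orthogonal to
      \<open>x\<close>.\<close>
    have "y + w \<in> supp d"
      using fs.subspace_add[OF subspace_supp] y(1) w(1) by blast
    moreover have "\<forall>i<k. dot d (h i) (y + w) = a i k"
      using y(2) w(2) by (simp add: dot_add)
    ultimately have yw: "y + w \<in> fs.span (v ` {..<k})" "dot d x (y + w) = a k k"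
      using corner by auto
    have "w \<in> fs.span (v ` {..<k})"
      using fs.span_diff[OF yw(1) y'(1)] by simp
    moreover have "dot d x w = 0"
      using yw(2) y'(2) by (simp add: dot_add)
    ultimately show "w \<in> {w \<in> fs.span (v ` {..<k}). dots d (Suc k) ?h w = 0}"
      using w(2) by (auto simp: dots_eq_0_iff less_Suc_eq)
  qed
  have entries: "dot d (?h i) (v j) = a i j" if "i < Suc k" "j < k" for i j
    using prod x that by (auto simp: less_Suc_eq)
  have "(\<lambda>j i. if i < Suc k then dot d (?h i) (v j) else 0) ` {..<k} = ?M ` {..<k}"
    using entries by (intro image_cong refl ext) auto
  then have "fs.dim (v ` {..<k}) = fs.dim (?M ` {..<k}) + fs.dim {w \<in> supp d. dots d k h w = 0}"
    using dim_image_dots[of v k "Suc k" d ?h] ker by simp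
  moreover have "fs.dim {w \<in> supp d. dots d k h w = 0} + fs.dim (h ` {..<k}) = d"
    using dim_kernel_dots h by blast
  \<comment> \<open>The coefficients that express \<open>y\<close> by the \<open>v j\<close> also
    express the new corner column by the old ones, so the last column adds no rank.\<close>
  moreover have "?M k \<in> fs.span (?M ` {..<k})"
  proof -
    have y': "y \<in> fs.span (v ` {..<k})" "dot d x y = a k k"
      using corner y by auto
    then obtain u where u: "y = (\<Sum>j<k. fscale (u j) (v j))"
      using fs.in_span_image_lessThan by blast
    have "dot d (?h i) y = a i k" if "i < Suc k" for i
      using that y(2) y'(2) by (auto simp: less_Suc_eq)
    then have "a i k = (\<Sum>j<k. u j * a i j)" if "i < Suc k" for i
      using entries[OF that] that unfolding u dot_sum dot_scale by (metis (no_types, lifting) lessThan_iff sum.cong)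
    then have "?M k = (\<Sum>j<k. fscale (u j) (?M j))"
      by (auto simp: fun_eq_iff pointwise)
    then show ?thesis
      using fs.in_span_image_lessThan by blast
  qed
  ultimately show ?thesis
    by (simp add: lessThan_Suc fs.dim_insert_finite del: less_Suc_eq)
qed

text \<open>With \<open>d = k + m\<close>, \<open>rank\<close> is the hypothesis at
  \<open>k + 1\<close>. The cases are whether row \<open>k\<close> and column \<open>k\<close> of
  \<open>a\<close> depend on earlier ones; the inequality enters when both are new.\<close>

lemma factor_step:
  fixes h v a :: "nat \<Rightarrow> nat \<Rightarrow> 'a::field"
  assumes h: "\<And>i. i < k \<Longrightarrow> h i \<in> supp d" and v: "\<And>j. j < k \<Longrightarrow> v j \<in> supp d"
    and prod: "\<And>i j. i < k \<Longrightarrow> j < k \<Longrightarrow> dot d (h i) (v j) = a i j"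
    and relh: "same_rel k h a" and relv: "same_rel k v (\<lambda>j i. a i j)"
    and rank: "fs.dim (a ` {..<Suc k}) + fs.dim ((\<lambda>j i. a i j) ` {..<Suc k})
      \<le> fs.dim ((\<lambda>j i. if i < Suc k then a i j else 0) ` {..<Suc k}) + Suc d"
  shows "\<exists>x y. x \<in> supp (Suc d) \<and> y \<in> supp (Suc d)
    \<and> (\<forall>j<k. dot (Suc d) x (v j) = a k j) \<and> (\<forall>i<k. dot (Suc d) (h i) y = a i k)
    \<and> dot (Suc d) x y = a k k
    \<and> same_rel (Suc k) (h(k := x)) a \<and> same_rel (Suc k) (v(k := y)) (\<lambda>j i. a i j)"
proof -
  let ?at = "\<lambda>j i. a i j"
  let ?e = "unitf d :: nat \<Rightarrow> 'a"
  obtain x0 where x0: "x0 \<in> supp d" "\<And>j. j < k \<Longrightarrow> dot d x0 (v j) = a k j"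
    using relation_transfer_solvable[OF v relv, of k] by blast
  obtain y0 where "y0 \<in> supp d" "\<And>i. i < k \<Longrightarrow> dot d y0 (h i) = a i k"
    using relation_transfer_solvable[of k h d ?at k] h relh by auto
  then have y0: "y0 \<in> supp d" "\<And>i. i < k \<Longrightarrow> dot d (h i) y0 = a i k"
    by (auto simp: dot_commute)
  have hU: "h ` {..<k} \<subseteq> supp d" and vU: "v ` {..<k} \<subseteq> supp d"
    using h v by auto
  have suc: "x \<in> supp (Suc d)" if "x \<in> supp d" for x :: "nat \<Rightarrow> 'a"
    using that supp_mono[of d "Suc d"] by auto
  have vd: "v j d = 0" if "j < k" for j
    using v[OF that] suppD by blast
  have hd: "h i d = 0" if "i < k" for i
    using h[OF that] suppD by blast
  have cut: "dot (Suc d) x y = dot d x y" if "x \<in> supp d \<or> y \<in> supp d" for x y :: "nat \<Rightarrow> 'a"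
    using that by (rule dot_cut) simp
  have row_new: "same_rel (Suc k) (h(k := x + fscale 1 ?e)) a"
    if "a k \<notin> fs.span (a ` {..<k})" "x \<in> supp d" for x
    using same_rel_Suc_notin[OF relh extend_notin_span[OF that(2) one_neq_zero hU] that(1)] .
  have col_new: "same_rel (Suc k) (v(k := y + fscale c ?e)) ?at"
    if "?at k \<notin> fs.span (?at ` {..<k})" "y \<in> supp d" "c \<noteq> 0" for y c
    using same_rel_Suc_notin[OF relv extend_notin_span[OF that(2,3) vU] that(1)] .
  \<comment> \<open>A dependent row dictates the same combination of the \<open>h i\<close>. The
    corner entry is then right for every \<open>y\<close> that solves the column equations, since
    \<open>a k k\<close> is that combination of the \<open>a i k\<close>.\<close>
  have row_old: "\<exists>x\<in>supp d. (\<forall>j<k. dot d x (v j) = a k j) \<and> same_rel (Suc k) (h(k := x)) a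
      \<and> (\<forall>y. (\<forall>i<k. dot d (h i) y = a i k) \<longrightarrow> dot d x y = a k k)"
    if "a k \<in> fs.span (a ` {..<k})"
  proof -
    obtain t where t: "a k = (\<Sum>i<k. fscale (t i) (a i))"
      using \<open>a k \<in> _\<close> fs.in_span_image_lessThan by blast
    define x where "x = (\<Sum>i<k. fscale (t i) (h i))"
    have akj: "a k j = (\<Sum>i<k. t i * a i j)" for j
      by (subst t) (simp add: pointwise)
    have "x \<in> supp d"
      unfolding x_def using h by (intro fs.subspace_sum fs.subspace_scale subspace_supp) auto
    moreover have "\<forall>j<k. dot d x (v j) = a k j"
      using prod by (simp add: x_def dot_sum_left dot_scale_left akj)
    moreover have "same_rel (Suc k) (h(k := x)) a"
      using relh x_def t by (rule same_rel_Suc_in)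
    moreover have "dot d x y = a k k" if "\<forall>i<k. dot d (h i) y = a i k" for y
      using that by (simp add: x_def dot_sum_left dot_scale_left akj)
    ultimately show ?thesis
      by blast
  qed
  have col_old: "\<exists>y\<in>supp d. (\<forall>i<k. dot d (h i) y = a i k) \<and> same_rel (Suc k) (v(k := y)) ?at
      \<and> (\<forall>x. (\<forall>j<k. dot d x (v j) = a k j) \<longrightarrow> dot d x y = a k k)"
    if "?at k \<in> fs.span (?at ` {..<k})"
  proof -
    from that have "\<exists>t. ?at k = (\<Sum>j<k. fscale (t j) (?at j))"
      by (simp only: fs.in_span_image_lessThan)
    then obtain t where t: "?at k = (\<Sum>j<k. fscale (t j) (?at j))"
      by (rule exE)
    define y where "y = (\<Sum>j<k. fscale (t j) (v j))"
    have aik: "a i k = (\<Sum>j<k. t j * a i j)" for i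
      using fun_cong[OF t, of i] by (simp add: pointwise)
    have "y \<in> supp d"
      unfolding y_def using v by (intro fs.subspace_sum fs.subspace_scale subspace_supp) auto
    moreover have "\<forall>i<k. dot d (h i) y = a i k"
      using prod by (simp add: y_def dot_sum dot_scale aik)
    moreover have "same_rel (Suc k) (v(k := y)) ?at"
      using relv y_def t by (rule same_rel_Suc_in)
    moreover have "dot d x y = a k k" if "\<forall>j<k. dot d x (v j) = a k j" for x
      using that by (simp add: y_def dot_sum dot_scale aik)
    ultimately show ?thesis
      by blast
  qed
  show ?thesis
  proof (cases "a k \<in> fs.span (a ` {..<k})")
    case row: True
    then obtain x where x: "x \<in> supp d" "\<forall>j<k. dot d x (v j) = a k j"
        "same_rel (Suc k) (h(k := x)) a"
        "\<And>y. \<forall>i<k. dot d (h i) y = a i k \<Longrightarrow> dot d x y = a k k"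
      using row_old by blast
    show ?thesis
    proof (cases "?at k \<in> fs.span (?at ` {..<k})")
      case True
      then obtain y where y: "y \<in> supp d" "\<forall>i<k. dot d (h i) y = a i k"
          "same_rel (Suc k) (v(k := y)) ?at"
        using col_old by blast
      show ?thesis
        using x y suc by (intro exI[of _ x] exI[of _ y]) (simp add: cut)
    next
      case False
      \<comment> \<open>\<open>x\<close> and all \<open>h i\<close> vanish at coordinate
        \<open>d\<close>, so adding the unit vector makes the column independent without changing
        any product.\<close>
      show ?thesis
        using x y0 suc col_new[OF False y0(1), of 1] extend_in_supp[OF y0(1), of 1]
        by (intro exI[of _ x] exI[of _ "y0 + fscale 1 ?e"])
          (simp add: cut dot_Suc_extend hd suppD del: fs.scale_one)
    qed
  next
    case row: False
    show ?thesis
    proof (cases "?at k \<in> fs.span (?at ` {..<k})")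
      case True
      then obtain y where y: "y \<in> supp d" "\<forall>i<k. dot d (h i) y = a i k"
          "same_rel (Suc k) (v(k := y)) ?at"
          "\<And>x. \<forall>j<k. dot d x (v j) = a k j \<Longrightarrow> dot d x y = a k k"
        using col_old by blast
      show ?thesis
        using x0 y suc row_new[OF row x0(1)] extend_in_supp[OF x0(1), of 1]
        by (intro exI[of _ "x0 + fscale 1 ?e"] exI[of _ y])
          (simp add: cut dot_Suc_extend vd suppD del: fs.scale_one)
    next
      case col: False
      \<comment> \<open>Otherwise \<open>dependent_corner_rank\<close> applies. Both full ranks grow
        by one, so the left side of \<open>rank\<close> would be the corner rank plus
        \<open>d + 2\<close>, against a right side with \<open>d + 1\<close>.\<close>
      have "\<exists>y. y \<in> supp d \<and> (\<forall>i<k. dot d (h i) y = a i k)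
          \<and> (dot d x0 y \<noteq> a k k \<or> y \<notin> fs.span (v ` {..<k}))"
      proof (rule ccontr)
        assume "\<not> ?thesis"
        then have "fs.dim (h ` {..<k}) + fs.dim (v ` {..<k})
            = fs.dim ((\<lambda>j i. if i < Suc k then a i j else 0) ` {..<Suc k}) + d"
          by (intro dependent_corner_rank[of k h d v a x0 y0] h v prod x0 y0) auto
        moreover have "fs.dim (a ` {..<Suc k}) = Suc (fs.dim (h ` {..<k}))"
          using row same_rel_dim[OF relh] by (simp add: lessThan_Suc fs.dim_insert_finite)
        moreover have "fs.dim (?at ` {..<Suc k}) = Suc (fs.dim (v ` {..<k}))"
          using col same_rel_dim[OF relv] by (simp add: lessThan_Suc fs.dim_insert_finite)
        ultimately show False
          using rank by linarith
      qed
      then obtain y where y: "y \<in> supp d" "\<forall>i<k. dot d (h i) y = a i k"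
          "dot d x0 y \<noteq> a k k \<or> y \<notin> fs.span (v ` {..<k})"
        by blast
      \<comment> \<open>The new coordinate contributes \<open>1 * c\<close> to the corner product.
        If \<open>c\<close> is nonzero, it also makes the column independent; if it is 0,
        \<open>y\<close> is itself outside the span.\<close>
      define c where "c = a k k - dot d x0 y"
      have "same_rel (Suc k) (v(k := y + fscale c ?e)) ?at"
      proof (cases "c = 0")
        case True
        then show ?thesis
          using y(3) col by (simp add: c_def same_rel_Suc_notin[OF relv])
      next
        case False
        then show ?thesis
          using col_new[OF col y(1)] by blast
      qed
      moreover have "dot (Suc d) (x0 + fscale 1 ?e) (y + fscale c ?e) = a k k"
        using x0(1) y(1) extend_in_supp[OF y(1), of c]
        by (simp add: dot_Suc_extend c_def del: fs.scale_one)
          (simp add: pointwise unitf_def suppD dot_def)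
      ultimately show ?thesis
        using x0 y row_new[OF row x0(1)] extend_in_supp[OF x0(1), of 1] extend_in_supp[OF y(1), of c]
        by (intro exI[of _ "x0 + fscale 1 ?e"] exI[of _ "y + fscale c ?e"])
          (simp add: dot_Suc_extend vd hd del: fs.scale_one)
    qed
  qed
qed

text \<open>The support bounds become the triangular shapes. The \<open>same_rel\<close> conjuncts
  strengthen the induction hypothesis so that the equations for the next row and column are
  solvable.\<close>

lemma factor_exists:
  fixes a :: "nat \<Rightarrow> nat \<Rightarrow> 'a::field"
  assumes "\<And>k. 1 \<le> k \<Longrightarrow> k \<le> n \<Longrightarrow>
      fs.dim (a ` {..<k}) + fs.dim ((\<lambda>j i. a i j) ` {..<k})
        \<le> fs.dim ((\<lambda>j i. if i < k then a i j else 0) ` {..<k}) + k + m"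
  shows "\<exists>h v. (\<forall>i<n. h i \<in> supp (Suc (m + i)) \<and> v i \<in> supp (Suc (m + i)))
    \<and> (\<forall>i<n. \<forall>j<n. dot (m + n) (h i) (v j) = a i j)
    \<and> same_rel n h a \<and> same_rel n v (\<lambda>j i. a i j)"
  using assms
proof (induction n)
  case 0
  show ?case
    by (simp add: same_rel_def)
next
  case (Suc k)
  have "\<exists>h v. (\<forall>i<k. h i \<in> supp (Suc (m + i)) \<and> v i \<in> supp (Suc (m + i)))
    \<and> (\<forall>i<k. \<forall>j<k. dot (m + k) (h i) (v j) = a i j)
    \<and> same_rel k h a \<and> same_rel k v (\<lambda>j i. a i j)"
    by (rule Suc.IH, rule Suc.prems) auto
  then obtain h v where hv: "\<And>i. i < k \<Longrightarrow> h i \<in> supp (Suc (m + i))"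
      "\<And>i. i < k \<Longrightarrow> v i \<in> supp (Suc (m + i))"
      "\<And>i j. i < k \<Longrightarrow> j < k \<Longrightarrow> dot (m + k) (h i) (v j) = a i j"
      "same_rel k h a" "same_rel k v (\<lambda>j i. a i j)"
    by blast
  have sub: "h i \<in> supp (m + k)" "v i \<in> supp (m + k)" if "i < k" for i
    using hv(1,2)[OF that] supp_mono[of "Suc (m + i)" "m + k"] that by auto
  obtain x y where xy: "x \<in> supp (Suc (m + k))" "y \<in> supp (Suc (m + k))"
      "\<And>j. j < k \<Longrightarrow> dot (Suc (m + k)) x (v j) = a k j"
      "\<And>i. i < k \<Longrightarrow> dot (Suc (m + k)) (h i) y = a i k"
      "dot (Suc (m + k)) x y = a k k"
      "same_rel (Suc k) (h(k := x)) a" "same_rel (Suc k) (v(k := y)) (\<lambda>j i. a i j)"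
    using factor_step[of k h "m + k" v a, OF sub hv(3-5)] Suc.prems[of "Suc k"]
    by (auto simp: algebra_simps)
  \<comment> \<open>The old vectors vanish at the new coordinate, so their products are
    unchanged.\<close>
  have old: "dot (Suc (m + k)) (h i) (v j) = a i j" if "i < k" "j < k" for i j
    using dot_cut[of "h i" "m + k" "v j" "Suc (m + k)"] sub(1)[OF that(1)] hv(3)[OF that] by simp
  let ?h = "h(k := x)" and ?v = "v(k := y)"
  have "\<forall>i<Suc k. ?h i \<in> supp (Suc (m + i)) \<and> ?v i \<in> supp (Suc (m + i))"
    using hv(1,2) xy(1,2) by (auto simp: less_Suc_eq)
  moreover have "\<forall>i<Suc k. \<forall>j<Suc k. dot (m + Suc k) (?h i) (?v j) = a i j"
    using old xy(3-5) by (auto simp: less_Suc_eq)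
  ultimately show ?case
    using xy(6,7) by blast
qed

text \<open>The linear map \<open>dots d n v\<close> sends \<open>h i\<close> to row
  \<open>a i\<close> and cannot raise dimension. With the roles of \<open>h\<close> and
  \<open>v\<close> exchanged, the same bound serves for columns.\<close>

lemma rank_le_of_factor:
  fixes h :: "nat \<Rightarrow> nat \<Rightarrow> 'a::field"
  assumes "\<And>i. i < k \<Longrightarrow> a i = dots d n v (h i)"
  shows "fs.dim (a ` {..<k}) \<le> fs.dim (h ` {..<k})"
proof -
  have "a ` {..<k} = dots d n v ` h ` {..<k}"
    using assms by (simp add: image_image)
  then show ?thesis
    using fsp.dim_image_le_finite[OF linear_dots, of "h ` {..<k}"] by simp
qed

section \<open>Matrix rank and submatrices in terms of functions\<close>

definition vec_fun :: "nat \<Rightarrow> 'a::field vec \<Rightarrow> nat \<Rightarrow> 'a" where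
  "vec_fun n w = (\<lambda>i. if i < n then w $ i else 0)"

lemma inj_on_vec_fun: "inj_on (vec_fun n) (carrier_vec n)"
proof (rule inj_onI)
  fix x y :: "'a vec"
  assume x: "x \<in> carrier_vec n" and y: "y \<in> carrier_vec n" and eq: "vec_fun n x = vec_fun n y"
  show "x = y"
  proof
    fix i
    assume "i < dim_vec y"
    then show "x $ i = y $ i"
      using y fun_cong[OF eq, of i] by (simp add: vec_fun_def)
  qed (use x y in auto)
qed

context vec_space
begin

lemma vec_fun_lincomb:
  assumes "X \<subseteq> carrier_vec n"
  shows "vec_fun n (lincomb a X) = (\<Sum>w\<in>X. fscale (a w) (vec_fun n w))"
  using assms by (auto simp: fun_eq_iff vec_fun_def pointwise lincomb_index)

text \<open>\<open>vec_fun n\<close> is injective on \<open>carrier_vec n\<close> and respects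
  linear combinations, so nontrivial relations transfer both ways, with coefficients relabelled
  along the bijection.\<close>

lemma lin_dep_iff_vec_fun:
  assumes "S \<subseteq> carrier_vec n"
  shows "lin_dep S \<longleftrightarrow> fs.dependent (vec_fun n ` S)"
proof
  have inj: "inj_on (vec_fun n) S"
    using assms inj_on_vec_fun inj_on_subset by blast
  have zero: "vec_fun n (0\<^sub>v n) = 0"
    by (simp add: vec_fun_def fun_eq_iff zero_fun_apply)
  show "fs.dependent (vec_fun n ` S)" if dep: "lin_dep S"
  proof -
    obtain X a v where X: "finite X" "X \<subseteq> S" "lincomb a X = 0\<^sub>v n" "v \<in> X" "a v \<noteq> 0"
      using dep unfolding lin_dep_def by auto
    have injX: "inj_on (vec_fun n) X"
      using inj X(2) inj_on_subset by blast
    let ?u = "\<lambda>x. a (the_inv_into X (vec_fun n) x)"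
    have "(\<Sum>x\<in>vec_fun n ` X. fscale (?u x) x) = (\<Sum>w\<in>X. fscale (a w) (vec_fun n w))"
      by (simp add: sum.reindex[OF injX] the_inv_into_f_f[OF injX])
    also have "\<dots> = 0"
      using vec_fun_lincomb[OF subset_trans[OF X(2) assms], of a] unfolding X(3) zero by (rule sym)
    finally show ?thesis
      unfolding fs.dependent_explicit using X the_inv_into_f_f[OF injX X(4)]
      by (intro exI[of _ "vec_fun n ` X"] exI[of _ ?u] conjI bexI[of _ "vec_fun n v"]) auto
  qed
  show "lin_dep S" if dep: "fs.dependent (vec_fun n ` S)"
  proof -
    obtain T u y where T: "finite T" "T \<subseteq> vec_fun n ` S" "(\<Sum>x\<in>T. fscale (u x) x) = 0"
        "y \<in> T" "u y \<noteq> 0"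
      using dep unfolding fs.dependent_explicit by blast
    obtain X where X: "X \<subseteq> S" "T = vec_fun n ` X"
      using T(2) by (meson subset_imageE)
    have injX: "inj_on (vec_fun n) X"
      using inj X(1) inj_on_subset by blast
    have XC: "X \<subseteq> carrier_vec n"
      using X(1) assms by blast
    have fin: "finite X"
      using T(1) X(2) injX finite_imageD by blast
    obtain w where w: "w \<in> X" "y = vec_fun n w"
      using T(4) X(2) by blast
    let ?a = "\<lambda>w. u (vec_fun n w)"
    have "vec_fun n (lincomb ?a X) = vec_fun n (0\<^sub>v n)"
      using vec_fun_lincomb[OF XC, of ?a] T(3) zero by (simp add: X(2) sum.reindex[OF injX])
    then have "lincomb ?a X = 0\<^sub>v n"
      using inj_on_vec_fun lincomb_closed[OF XC, of ?a] by (auto dest!: inj_onD)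
    then show ?thesis
      unfolding lin_dep_def using fin X(1) w T(5) by auto
  qed
qed

text \<open>The rank is the size of a maximal independent set of columns, and the image of such a
  set is a basis of the span of the embedded columns.\<close>

lemma rank_eq_dim_vec_fun:
  assumes "A \<in> carrier_mat n nc"
  shows "rank A = fs.dim (vec_fun n ` set (cols A))"
proof -
  let ?C = "set (cols A)"
  have C: "?C \<subseteq> carrier_vec n"
    using cols_dim assms by blast
  have "lin_indpt {}"
    by (simp add: lin_dep_def)
  then obtain S where S: "maximal S (\<lambda>T. T \<subseteq> ?C \<and> lin_indpt T)"
    using maximal_exists_superset[of ?C "\<lambda>T. T \<subseteq> ?C \<and> lin_indpt T" "{}"] by auto
  then have SC: "S \<subseteq> ?C" and ind: "lin_indpt S"
    by (auto simp: maximal_def)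
  have indS: "fs.independent (vec_fun n ` S)"
    using ind lin_dep_iff_vec_fun SC C by blast
  have "fs.dim (vec_fun n ` ?C) = card (vec_fun n ` S)"
  proof (rule fs.dim_unique[OF _ _ indS refl])
    show "vec_fun n ` S \<subseteq> vec_fun n ` ?C"
      using SC by blast
    show "vec_fun n ` ?C \<subseteq> fs.span (vec_fun n ` S)"
    proof (rule image_subsetI, rule ccontr)
      fix w
      assume w: "w \<in> ?C" and notin: "vec_fun n w \<notin> fs.span (vec_fun n ` S)"
      then have "fs.independent (vec_fun n ` insert w S)"
        using indS by (simp add: fs.independent_insert)
      then have "lin_indpt (insert w S)"
        using lin_dep_iff_vec_fun[of "insert w S"] SC C w by blast
      then have "insert w S = S"
        using S w SC unfolding maximal_def by blast
      then show False
        using notin fs.span_base by blast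
    qed
  qed
  also have "\<dots> = card S"
    using inj_on_vec_fun SC C by (metis card_image inj_on_subset order_trans)
  finally show ?thesis
    using rank_card_indpt[OF assms S] by simp
qed

end

lemma mat_rank_mat:
  "mat_rank (mat p q (\<lambda>(i, j). f i j)) = fs.dim ((\<lambda>j i. if i < p then f i j else 0) ` {..<q})"
proof -
  let ?A = "mat p q (\<lambda>(i, j). f i j)"
  have "vec_fun p (col ?A j) = (\<lambda>i. if i < p then f i j else 0)" if "j < q" for j
    using that by (auto simp: vec_fun_def)
  then have "vec_fun p ` set (cols ?A) = (\<lambda>j i. if i < p then f i j else 0) ` {..<q}"
    by (simp add: cols_def image_image atLeast0LessThan)
  then show ?thesis
    using vec_space.rank_eq_dim_vec_fun[of ?A p q] by (simp add: mat_rank_def)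
qed

text \<open>A submatrix index counts the smaller members of the index set; in an interval starting
  at \<open>b\<close> exactly \<open>l\<close> members lie below \<open>b + l\<close>, so selection
  is a shift.\<close>

lemma submatrix_ranges:
  assumes "q \<le> dim_row A" "s \<le> dim_col A"
  shows "submatrix A {p..<q} {r..<s} = mat (q - p) (s - r) (\<lambda>(i, j). A $$ (p + i, r + j))"
proof (rule eq_matI)
  have card: "card {i. i < d \<and> i \<in> {b..<e}} = e - b" if "e \<le> d" for b d e :: nat
  proof -
    have "{i. i < d \<and> i \<in> {b..<e}} = {b..<e}"
      using that by auto
    then show ?thesis
      by simp
  qed
  show "dim_row (submatrix A {p..<q} {r..<s}) = dim_row (mat (q - p) (s - r) (\<lambda>(i, j). A $$ (p + i, r + j)))"
    "dim_col (submatrix A {p..<q} {r..<s}) = dim_col (mat (q - p) (s - r) (\<lambda>(i, j). A $$ (p + i, r + j)))"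
    using assms by (simp_all add: dim_submatrix card del: atLeastLessThan_iff)
  fix i j
  assume "i < dim_row (mat (q - p) (s - r) (\<lambda>(i, j). A $$ (p + i, r + j)))"
    and "j < dim_col (mat (q - p) (s - r) (\<lambda>(i, j). A $$ (p + i, r + j)))"
  then have ij: "i < q - p" "j < s - r"
    by simp_all
  have below: "card {a \<in> {b..<e}. a < b + l} = l" if "l < e - b" for b e l :: nat
  proof -
    have "{a \<in> {b..<e}. a < b + l} = {b..<b + l}"
      using that by auto
    then show ?thesis
      by simp
  qed
  show "submatrix A {p..<q} {r..<s} $$ (i, j) = mat (q - p) (s - r) (\<lambda>(i, j). A $$ (p + i, r + j)) $$ (i, j)"
    using submatrix_index_card[of "p + i" A "r + j" "{p..<q}" "{r..<s}"] ij assms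
    by (simp add: below del: atLeastLessThan_iff) (simp add: less_diff_conv add.commute)
qed

section \<open>Translating both directions to matrices\<close>

theorem theorem5:
  fixes A :: "'a::field mat" and n m :: nat
  assumes "n \<ge> 1" and "A \<in> carrier_mat n n"
  shows "(\<exists>H V. almost_lower_triangular n m H \<and> almost_upper_triangular n m V \<and> A = H * V) \<longleftrightarrow>
    (\<forall>k \<in> {1..n}.
       mat_rank (submatrix A {0..<k} {0..<k}) + k + m
         \<ge> mat_rank (submatrix A {0..<k} {0..<n}) + mat_rank (submatrix A {0..<n} {0..<k}))"
proof -
  \<comment> \<open>The default 0 outside the square lets whole rows and columns of \<open>a\<close>
    stand for those of \<open>A\<close> without truncation.\<close>
  define a where "a = (\<lambda>i j. if i < n \<and> j < n then A $$ (i, j) else 0)"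
  have a_0: "a i j = 0" if "n \<le> i \<or> n \<le> j" for i j
    using that by (auto simp: a_def)
  have sub: "submatrix A {0..<p} {0..<q} = mat p q (\<lambda>(i, j). a i j)" if "p \<le> n" "q \<le> n" for p q
    using submatrix_ranges[of p A q 0 0] assms(2) that by (auto simp: a_def intro!: cong_mat)
  have rank_rows: "mat_rank (submatrix A {0..<k} {0..<n}) = fs.dim (a ` {..<k})" if "k \<le> n" for k
  proof -
    have "(\<lambda>i j. if j < n then a i j else 0) = a"
      by (auto simp: fun_eq_iff a_0)
    from row_rank_eq_col_rank[of n a k, unfolded this] show ?thesis
      using that by (simp add: sub mat_rank_mat)
  qed
  have rank_cols: "mat_rank (submatrix A {0..<n} {0..<k}) = fs.dim ((\<lambda>j i. a i j) ` {..<k})"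
    if "k \<le> n" for k
  proof -
    have "(\<lambda>j i. if i < n then a i j else 0) = (\<lambda>j i. a i j)"
      by (auto simp: fun_eq_iff a_0)
    from mat_rank_mat[of n k a, unfolded this] show ?thesis
      using that by (simp add: sub)
  qed
  have rank_corner: "mat_rank (submatrix A {0..<k} {0..<k})
      = fs.dim ((\<lambda>j i. if i < k then a i j else 0) ` {..<k})" if "k \<le> n" for k
    using that by (simp add: sub mat_rank_mat)
  show ?thesis (is "?L \<longleftrightarrow> ?R")
  proof
    assume ?L
    then obtain H V where H: "almost_lower_triangular n m H" and V: "almost_upper_triangular n m V"
      and A: "A = H * V"
      by blast
    have Hc: "H \<in> carrier_mat n (n + m)" and Vc: "V \<in> carrier_mat (n + m) n"
      using H V by (auto simp: almost_lower_triangular_def almost_upper_triangular_def)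
    have "submatrix H {0..<n} {m..<n + m} = mat n n (\<lambda>(i, j). H $$ (i, m + j))"
      using submatrix_ranges[of n H "n + m" 0 m] Hc by simp
    then have H0: "H $$ (i, m + j) = 0" if "i < j" "j < n" for i j
      using H that by (auto simp: almost_lower_triangular_def lower_triangular_def)
    have "submatrix V {m..<n + m} {0..<n} = mat n n (\<lambda>(i, j). V $$ (m + i, j))"
      using submatrix_ranges[of "n + m" V n m 0] Vc by simp
    then have V0: "V $$ (m + i, j) = 0" if "j < i" "i < n" for i j
      using V that by (auto simp: almost_upper_triangular_def upper_triangular_def)
    define h where "h = (\<lambda>i l. if l < n + m then H $$ (i, l) else 0)"
    define v where "v = (\<lambda>j l. if l < n + m then V $$ (l, j) else 0)"
    \<comment> \<open>From \<open>l = m + k\<close> on, \<open>l - m\<close> exceeds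
      \<open>i\<close>, so the entry is 0 by triangularity, or by the default once \<open>l\<close>
      reaches \<open>n + m\<close>.\<close>
    have h: "h i \<in> supp (m + k)" and v: "v i \<in> supp (m + k)" if "i < k" for i k
    proof -
      have "h i l = 0 \<and> v i l = 0" if "m + k \<le> l" for l
        using H0[of i "l - m"] V0[of i "l - m"] that \<open>i < k\<close> by (auto simp: h_def v_def)
      then show "h i \<in> supp (m + k)" "v i \<in> supp (m + k)"
        by (auto simp: supp_def)
    qed
    have prod: "a i j = dot (n + m) (h i) (v j)" if "i < n" "j < n" for i j
      using that Hc Vc
      by (auto simp: a_def A scalar_prod_def dot_def h_def v_def atLeast0LessThan intro!: sum.cong)
    show ?R
    proof
      fix k
      assume "k \<in> {1..n}"
      then have k: "k \<le> n"
        by simp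
      have "a i = dots (n + m) n v (h i)" if "i < k" for i
        using that k prod a_0 by (auto simp: dots_def fun_eq_iff dot_commute[of _ "h i"])
      then have "fs.dim (a ` {..<k}) \<le> fs.dim (h ` {..<k})"
        by (rule rank_le_of_factor)
      moreover have "(\<lambda>i. a i j) = dots (n + m) n h (v j)" if "j < k" for j
        using that k prod a_0 by (auto simp: dots_def fun_eq_iff)
      then have "fs.dim ((\<lambda>j i. a i j) ` {..<k}) \<le> fs.dim (v ` {..<k})"
        by (rule rank_le_of_factor)
      \<comment> \<open>The first \<open>k\<close> rows and columns are supported below
        \<open>m + k\<close>, so the inner width drops from \<open>n + m\<close> to
        \<open>m + k\<close>, the width at which Sylvester's inequality is applied.\<close>
      moreover have "dot (m + k) (h i) (v j) = a i j" if "i < k" "j < k" for i j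
        using that k prod[of i j] dot_cut[of "h i" "m + k" "v j" "n + m"] h[of i k] by simp
      then have "(\<lambda>j i. if i < k then dot (m + k) (h i) (v j) else 0) ` {..<k}
          = (\<lambda>j i. if i < k then a i j else 0) ` {..<k}"
        by (intro image_cong refl) auto
      then have "fs.dim (h ` {..<k}) + fs.dim (v ` {..<k})
          \<le> fs.dim ((\<lambda>j i. if i < k then a i j else 0) ` {..<k}) + (m + k)"
        using sylvester_rank[of k h "m + k" k v, OF h v] by simp
      ultimately show "mat_rank (submatrix A {0..<k} {0..<k}) + k + m
          \<ge> mat_rank (submatrix A {0..<k} {0..<n}) + mat_rank (submatrix A {0..<n} {0..<k})"
        using k by (simp add: rank_rows rank_cols rank_corner)
    qed
  next
    assume R: ?R
    have "\<exists>h v. (\<forall>i<n. h i \<in> supp (Suc (m + i)) \<and> v i \<in> supp (Suc (m + i)))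
      \<and> (\<forall>i<n. \<forall>j<n. dot (m + n) (h i) (v j) = a i j)
      \<and> same_rel n h a \<and> same_rel n v (\<lambda>j i. a i j)"
      using R by (intro factor_exists) (auto simp: rank_rows rank_cols rank_corner)
    then obtain h v where h: "\<And>i. i < n \<Longrightarrow> h i \<in> supp (Suc (m + i))"
      and v: "\<And>i. i < n \<Longrightarrow> v i \<in> supp (Suc (m + i))"
      and prod: "\<And>i j. i < n \<Longrightarrow> j < n \<Longrightarrow> dot (m + n) (h i) (v j) = a i j"
      by blast
    define H where "H = mat n (n + m) (\<lambda>(i, l). h i l)"
    define V where "V = mat (n + m) n (\<lambda>(l, j). v j l)"
    have "submatrix H {0..<n} {m..<n + m} = mat n n (\<lambda>(i, j). h i (m + j))"
      using submatrix_ranges[of n H "n + m" 0 m] by (auto simp: H_def intro!: cong_mat)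
    \<comment> \<open>\<open>h i\<close> vanishes from position \<open>m + i + 1\<close> on, which
      is strictly above the diagonal after the shift by \<open>m\<close>.\<close>
    then have "almost_lower_triangular n m H"
      using suppD[OF h] by (auto simp: almost_lower_triangular_def lower_triangular_def H_def)
    moreover have "submatrix V {m..<n + m} {0..<n} = mat n n (\<lambda>(i, j). v j (m + i))"
      using submatrix_ranges[of "n + m" V n m 0] by (auto simp: V_def intro!: cong_mat)
    then have "almost_upper_triangular n m V"
      using suppD[OF v] by (auto simp: almost_upper_triangular_def upper_triangular_def V_def)
    moreover have "A = H * V"
    proof (rule eq_matI)
      fix i j
      assume "i < dim_row (H * V)" "j < dim_col (H * V)"
      then have ij: "i < n" "j < n"
        by (simp_all add: H_def V_def)
      then have "(H * V) $$ (i, j) = dot (m + n) (h i) (v j)"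
        by (simp add: H_def V_def scalar_prod_def dot_def atLeast0LessThan add.commute)
      then show "A $$ (i, j) = (H * V) $$ (i, j)"
        using prod ij by (simp add: a_def)
    qed (use assms(2) in \<open>auto simp: H_def V_def\<close>)
    ultimately show ?L
      by blast
  qed
qed

end
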